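(* The set of prime numbers gets arbitrarily close to arbitrarily long arithmetic progressions. That is, writing $X \subseteq \mathbb{Z}$ for the set of all (positive) prime numbers, for every integer $k \geq 1$ and every real $\varepsilon > 0$ there exists an arithmetic progression $P \subseteq \mathbb{R}$ of length $k$ and gap size $\Delta > 0$ such that \[ \sup_{p \in P} \inf_{x \in X} |p - x| \leq \varepsilon \Delta . \]
   Context: An arithmetic progression of length $k \geq 1$ ($k$ an integer) and gap size $\Delta > 0$ ($\Delta$ real) is a set of the form $\{x, x+\Delta, x+2\Delta, \dots, x+(k-1)\Delta\}$ for some $x \in \mathbb{R}$. A set of positive integers $X \subseteq \mathbb{Z}$ gets arbitrarily close to arbitrarily long arithmetic progressions if, for all $k \in \mathbb{N}$ (that is, all integers $k \geq 1$) and all $\varepsilon > 0$, there exists an arithmetic progression $P$ of length $k$ and gap size $\Delta > 0$ such that $\sup_{p \in P} \inf_{x \in X} |p-x| \leq \varepsilon \Delta$. The starting point $x$ and the gap size $\Delta$ of $P$ are allowed to be arbitrary real numbers (with $\Delta>0$), and $\Delta$ may depend on $k$ and $\varepsilon$. *)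

theory Defs
  imports "HOL-Analysis.Analysis" "HOL-Computational_Algebra.Primes"
begin

definition arithmetic_progression :: "nat \<Rightarrow> real \<Rightarrow> real set \<Rightarrow> bool" where
  "arithmetic_progression k \<Delta> P \<longleftrightarrow>
     k \<ge> 1 \<and> \<Delta> > 0 \<and> (\<exists>x::real. P = {x + real i * \<Delta> | i. i < k})"

(* The supremum and infimum are taken in the extended reals, so that the distance
   to the empty set is infinite and nothing depends on unspecified values of Inf
   and Sup on the type real. *)
definition close_to_long_APs :: "int set \<Rightarrow> bool" where
  "close_to_long_APs X \<longleftrightarrow>
     (\<forall>k::nat. \<forall>\<epsilon>::real. k \<ge> 1 \<longrightarrow> \<epsilon> > 0 \<longrightarrow>
        (\<exists>\<Delta> P. arithmetic_progression k \<Delta> P \<and>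
           (SUP p\<in>P. INF x\<in>X. ereal \<bar>p - real_of_int x\<bar>) \<le> ereal (\<epsilon> * \<Delta>)))"

end

theory Submission
  imports Defs "HOL-Computational_Algebra.Squarefree"
begin

text \<open>
  Suppose a set \<open>X\<close> of naturals stays away from all progressions of length \<open>k\<close> at relative
  distance \<open>\<epsilon>\<close>, and put \<open>M = k m\<close> with \<open>m \<ge> 1 / \<epsilon>\<close>. Cut an interval of length \<open>M L\<close> into \<open>M\<close>
  pieces of length \<open>L\<close>. If all pieces met \<open>X\<close>, the left endpoints of every \<open>m\<close>-th piece would form
  a progression of gap \<open>m L\<close> whose points are within \<open>L \<le> \<epsilon> m L\<close> of \<open>X\<close>; so some piece misses \<open>X\<close>.
  Iterating over the scales \<open>M\<^sup>n\<close>, an interval of length \<open>M\<^sup>n\<close> contains at most \<open>(M - 1)\<^sup>n\<close> elements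
  of \<open>X\<close>, and hence the reciprocals of \<open>X\<close> have a finite sum. For the primes that sum is
  infinite, by the counting argument of Erdos.
\<close>

text \<open>Write \<open>n\<close> as its squarefree part times a square. The squarefree part is
  determined by its set of prime factors, a subset of \<open>P\<close>, and the root of the square
  is at most \<open>x\<close>.\<close>

lemma card_smooth_le:
  fixes P :: "nat set"
  assumes "finite P"
  shows "card {n \<in> {1..x\<^sup>2}. prime_factors n \<subseteq> P} \<le> 2 ^ card P * x"
proof -
  let ?S = "{n \<in> {1..x\<^sup>2}. prime_factors n \<subseteq> P}"
  let ?f = "\<lambda>n::nat. (prime_factors (squarefree_part n), square_part n)"
  have sf: "squarefree_part n = \<Prod>(prime_factors (squarefree_part n))" for n :: nat
  proof -
    have "squarefree_part n
        = (\<Prod>p\<in>prime_factors (squarefree_part n). p ^ multiplicity p (squarefree_part n))"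
      by (simp add: prod_prime_factors)
    also have "\<dots> = \<Prod>(prime_factors (squarefree_part n))"
    proof (rule prod.cong)
      fix p assume "p \<in> prime_factors (squarefree_part n)"
      then have "multiplicity p (squarefree_part n) > 0" "prime p"
        by (auto simp: prime_factors_multiplicity)
      then have "multiplicity p (squarefree_part n) = 1"
        \<comment> \<open>This multiplicity is the parity of the multiplicity of \<open>p\<close> in
          \<open>n\<close>, so positive means 1.\<close>
        using prime_multiplicity_squarefree_part[of p n] by (metis not_mod_2_eq_0_eq_1 neq0_conv)
      then show "p ^ multiplicity p (squarefree_part n) = p" by simp
    qed simp
    finally show ?thesis .
  qed
  have "inj_on ?f ?S"
  proof (rule inj_onI, rule squarefree_decomposition_unique)
    fix n n' assume "?f n = ?f n'"
    then have "square_part n = square_part n'"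
      and *: "prime_factors (squarefree_part n) = prime_factors (squarefree_part n')"
      by (simp_all only: prod.inject)
    then show "square_part n = square_part n'" by simp
    show "squarefree_part n = squarefree_part n'"
      using sf[of n] sf[of n'] unfolding * by (rule trans[OF _ sym])
  qed
  moreover have "?f ` ?S \<subseteq> Pow P \<times> {1..x}"
  proof
    fix y assume "y \<in> ?f ` ?S"
    then obtain n where n: "1 \<le> n" "n \<le> x\<^sup>2" "prime_factors n \<subseteq> P" "y = ?f n" by auto
    have "squarefree_part n dvd n" by (subst (2) squarefree_decompose) simp
    then have "prime_factors (squarefree_part n) \<subseteq> P"
      using n dvd_prime_factors[of n "squarefree_part n"] by auto
    moreover have "(square_part n)\<^sup>2 \<le> x\<^sup>2"
      using n dvd_imp_le[OF square_part_square_dvd, of n] by linarith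
    then have "square_part n \<le> x" by (simp add: power2_nat_le_eq_le)
    moreover have "1 \<le> square_part n" using n square_part_0_iff[of n] by linarith
    ultimately show "y \<in> Pow P \<times> {1..x}" using n(4) by auto
  qed
  ultimately have "card ?S \<le> card (Pow P \<times> {1..x})"
    using assms by (intro card_inj_on_le[of ?f]) auto
  then show ?thesis using assms by (simp add: card_cartesian_product card_Pow)
qed

lemma card_multiples_le:
  fixes p N :: nat
  assumes "p > 0"
  shows "real (card {n \<in> {1..N}. p dvd n}) \<le> real N / real p"
proof -
  have "{n \<in> {1..N}. p dvd n} \<subseteq> (\<lambda>i. p * i) ` {1..N div p}"
  proof
    fix n assume "n \<in> {n \<in> {1..N}. p dvd n}"
    then have "p dvd n" "1 \<le> n" "n \<le> N" by auto
    then obtain i where i: "n = p * i" by (auto elim: dvdE)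
    then have "i \<ge> 1" "i \<le> N div p"
      using \<open>1 \<le> n\<close> \<open>n \<le> N\<close> assms
      by (auto simp: less_eq_div_iff_mult_less_eq mult.commute Suc_le_eq)
    then show "n \<in> (\<lambda>i. p * i) ` {1..N div p}" using i by auto
  qed
  then have "card {n \<in> {1..N}. p dvd n} \<le> card {1..N div p}"
    by (rule surj_card_le[rotated]) simp
  then have "real (card {n \<in> {1..N}. p dvd n}) \<le> real (N div p)" by simp
  also have "\<dots> \<le> real N / real p" by (rule of_nat_div_le_of_nat)
  finally show ?thesis .
qed

text \<open>If the series converged, the primes from some \<open>K\<close> on would have reciprocal
  sum below 1/2, so fewer than half of the numbers up to \<open>x\<^sup>2\<close> would have a prime
  factor in that tail. The others are built from the finitely many primes below \<open>K\<close>,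
  and there are only O(\<open>x\<close>) of them.\<close>

theorem not_summable_reciprocal_primes:
  "\<not> summable (\<lambda>n. if n \<in> {p::nat. prime p} then 1 / real n else 0)"
proof
  let ?f = "\<lambda>n::nat. if n \<in> {p::nat. prime p} then 1 / real n else 0"
  assume "summable ?f"
  then obtain K where K: "\<And>m n. m \<ge> K \<Longrightarrow> norm (sum ?f {m..<n}) < 1 / 2"
    unfolding summable_Cauchy using half_gt_zero[OF zero_less_one] by blast
  define P where "P = {p. prime p \<and> p < K}"
  \<comment> \<open>Chosen so that the smooth count \<open>2 ^ card P * x\<close> is exactly half of
    \<open>x\<^sup>2\<close>.\<close>
  define x :: nat where "x = 2 ^ (card P + 1)"
  let ?Q = "{p \<in> {K..<Suc (x\<^sup>2)}. prime p}"
  let ?S = "{n \<in> {1..x\<^sup>2}. prime_factors n \<subseteq> P}"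
  let ?D = "\<lambda>p. {n \<in> {1..x\<^sup>2}. p dvd n}"
  have "finite P" by (simp add: P_def)
  have "{1..x\<^sup>2} \<subseteq> ?S \<union> (\<Union>p\<in>?Q. ?D p)"
  proof
    fix n assume n: "n \<in> {1..x\<^sup>2}"
    show "n \<in> ?S \<union> (\<Union>p\<in>?Q. ?D p)"
    proof (cases "prime_factors n \<subseteq> P")
      case False
      then obtain p where "prime p" "p dvd n" "p \<notin> P" by auto
      moreover from this have "p \<le> n" using n by (auto intro: dvd_imp_le)
      ultimately have "p \<in> ?Q" "n \<in> ?D p" using n by (auto simp: P_def)
      then show ?thesis by blast
    qed (use n in auto)
  qed
  then have "card {1..x\<^sup>2} \<le> card (?S \<union> (\<Union>p\<in>?Q. ?D p))" by (intro card_mono) auto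
  also have "\<dots> \<le> card ?S + card (\<Union>p\<in>?Q. ?D p)" by (rule card_Un_le)
  also have "\<dots> \<le> 2 ^ card P * x + (\<Sum>p\<in>?Q. card (?D p))"
    using \<open>finite P\<close> by (intro add_mono card_smooth_le card_UN_le) auto
  finally have "real (x\<^sup>2) \<le> real (2 ^ card P * x + (\<Sum>p\<in>?Q. card (?D p)))"
    by (subst of_nat_le_iff) simp
  also have "\<dots> = 2 ^ card P * real x + (\<Sum>p\<in>?Q. real (card (?D p)))" by simp
  also have "(\<Sum>p\<in>?Q. real (card (?D p))) \<le> (\<Sum>p\<in>?Q. real (x\<^sup>2) * (1 / real p))"
  proof (rule sum_mono)
    fix p assume "p \<in> ?Q"
    then have "p > 0" by (auto intro: prime_gt_0_nat)
    then show "real (card (?D p)) \<le> real (x\<^sup>2) * (1 / real p)"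
      using card_multiples_le[of p "x\<^sup>2"] by simp
  qed
  also have "\<dots> = real (x\<^sup>2) * (\<Sum>p\<in>?Q. 1 / real p)" by (simp only: sum_distrib_left)
  also have "(\<Sum>p\<in>?Q. 1 / real p) = sum ?f {K..<Suc (x\<^sup>2)}"
    by (simp only: sum.inter_filter[OF finite_atLeastLessThan] mem_Collect_eq)
  finally have "real (x\<^sup>2) \<le> 2 ^ card P * real x + real (x\<^sup>2) * sum ?f {K..<Suc (x\<^sup>2)}"
    by simp
  moreover have "real (x\<^sup>2) * sum ?f {K..<Suc (x\<^sup>2)} < real (x\<^sup>2) * (1 / 2)"
  proof (rule mult_strict_left_mono)
    show "sum ?f {K..<Suc (x\<^sup>2)} < 1 / 2" using K[of K "Suc (x\<^sup>2)"] by (simp only: real_norm_def) linarith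
  qed (simp add: x_def)
  moreover have "2 ^ card P * real x = real (x\<^sup>2) / 2" by (simp add: x_def power2_eq_square)
  ultimately show False by linarith
qed

text \<open>Induction on the scale: of the \<open>M\<close> blocks of length \<open>M ^ n\<close>
  one is empty by \<open>gap\<close>, and the induction hypothesis bounds each of the other
  \<open>M - 1\<close>.\<close>

lemma card_interval_le_pow:
  fixes X :: "nat set"
  assumes gap: "\<And>a L. L > 0 \<Longrightarrow> \<exists>i<M. X \<inter> {a + i * L..<a + (i + 1) * L} = {}"
  shows "card (X \<inter> {a..<a + M ^ n}) \<le> (M - 1) ^ n"
proof (induction n arbitrary: a)
  case 0
  have "card (X \<inter> {a..<a + M ^ 0}) \<le> card {a}" by (intro card_mono) auto
  then show ?case by simp
next
  case (Suc n)
  have "M > 0" using gap[of 1 0] by auto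
  define L where "L = M ^ n"
  have "L > 0" using \<open>M > 0\<close> by (simp add: L_def)
  let ?J = "\<lambda>i. X \<inter> {a + i * L..<a + (i + 1) * L}"
  obtain i where i: "i < M" "?J i = {}" using gap[OF \<open>L > 0\<close>, of a] by auto
  have "X \<inter> {a..<a + M ^ Suc n} \<subseteq> (\<Union>j\<in>{..<M} - {i}. ?J j)"
  proof
    fix y assume y: "y \<in> X \<inter> {a..<a + M ^ Suc n}"
    define j where "j = (y - a) div L"
    have "y - a < M * L" using y by (auto simp: L_def)
    then have "j < M" using \<open>L > 0\<close> by (simp add: j_def less_mult_imp_div_less)
    moreover have "j * L \<le> y - a" "y - a < (j + 1) * L"
      using \<open>L > 0\<close> dividend_less_div_times[of L "y - a"] by (auto simp: j_def)
    then have "y \<in> ?J j" using y by auto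
    moreover from this have "j \<noteq> i" using i by auto
    ultimately show "y \<in> (\<Union>j\<in>{..<M} - {i}. ?J j)" by blast
  qed
  then have "card (X \<inter> {a..<a + M ^ Suc n}) \<le> card (\<Union>j\<in>{..<M} - {i}. ?J j)"
    by (intro card_mono) auto
  also have "\<dots> \<le> (\<Sum>j\<in>{..<M} - {i}. card (?J j))" by (rule card_UN_le) simp
  also have "\<dots> \<le> (\<Sum>j\<in>{..<M} - {i}. (M - 1) ^ n)"
  proof (rule sum_mono)
    fix j
    show "card (?J j) \<le> (M - 1) ^ n" using Suc.IH[of "a + j * L"] by (simp add: L_def algebra_simps)
  qed
  also have "\<dots> = (M - 1) ^ Suc n" using i by simp
  finally show ?case .
qed

text \<open>Grouping the terms between consecutive powers of \<open>M\<close> gives a comparison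
  with a geometric series of ratio \<open>q = (M - 1) / M < 1\<close>.\<close>

lemma summable_reciprocals_if_sparse:
  fixes X :: "nat set"
  assumes "M \<ge> 2" and sparse: "\<And>a n. card (X \<inter> {a..<a + M ^ n}) \<le> (M - 1) ^ n"
  shows "summable (\<lambda>n. if n \<in> X then 1 / real n else 0)"
proof -
  let ?f = "\<lambda>n. if n \<in> X then 1 / real n else 0"
  define q where "q = (real M - 1) / real M"
  have q: "0 \<le> q" "q < 1" "1 - q = 1 / real M" using assms(1) by (auto simp: q_def field_simps)
  have block: "sum ?f {M ^ n..<M ^ Suc n} \<le> (real M - 1) * q ^ n" for n
  proof -
    have "sum ?f {M ^ n..<M ^ Suc n} = (\<Sum>i\<in>X \<inter> {M ^ n..<M ^ Suc n}. 1 / real i)"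
      by (subst Int_commute) (simp add: sum.inter_restrict)
    also have "\<dots> \<le> real (card (X \<inter> {M ^ n..<M ^ Suc n})) * (1 / real (M ^ n))"
    proof (rule sum_bounded_above)
      fix i assume "i \<in> X \<inter> {M ^ n..<M ^ Suc n}"
      then have "real (M ^ n) \<le> real i" by (subst of_nat_le_iff) simp
      moreover have "real (M ^ n) > 0" using assms(1) by simp
      ultimately show "1 / real i \<le> 1 / real (M ^ n)" by (simp add: frac_le)
    qed
    also have "\<dots> \<le> real ((M - 1) ^ Suc n) * (1 / real (M ^ n))"
    proof (intro mult_right_mono of_nat_mono)
      \<comment> \<open>The interval is enlarged because \<open>sparse\<close> speaks only of
        lengths that are powers of \<open>M\<close>.\<close>
      have "card (X \<inter> {M ^ n..<M ^ Suc n}) \<le> card (X \<inter> {M ^ n..<M ^ n + M ^ Suc n})"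
        by (intro card_mono) auto
      also have "\<dots> \<le> (M - 1) ^ Suc n" by (rule sparse)
      finally show "card (X \<inter> {M ^ n..<M ^ Suc n}) \<le> (M - 1) ^ Suc n" .
    qed simp
    also have "\<dots> = (real M - 1) * q ^ n"
      using assms(1) by (simp add: q_def of_nat_diff power_divide)
    finally show ?thesis .
  qed
  have bound: "sum ?f {..<M ^ N} \<le> (\<Sum>n<N. (real M - 1) * q ^ n)" for N
  proof (induction N)
    case 0
    \<comment> \<open>The term at 0 vanishes even if 0 lies in \<open>X\<close>, since
      \<open>1 / 0 = 0\<close>.\<close>
    have "{..<M ^ 0} = {0}" by auto
    then show ?case by (simp only:) simp
  next
    case (Suc N)
    have "M ^ N \<le> M ^ Suc N" using assms(1) by simp
    then have "sum ?f {..<M ^ Suc N} = sum ?f {..<M ^ N} + sum ?f {M ^ N..<M ^ Suc N}"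
      unfolding lessThan_atLeast0 by (intro sum.atLeastLessThan_concat[symmetric]) auto
    also have "\<dots> \<le> (\<Sum>n<Suc N. (real M - 1) * q ^ n)"
      using add_mono[OF Suc block[of N]] by (simp only: sum.lessThan_Suc)
    finally show ?case .
  qed
  show ?thesis
  proof (rule summableI_nonneg_bounded)
    fix N
    have "N \<le> M ^ N" by (intro less_imp_le power_gt_expt) (use assms(1) in simp)
    then have "sum ?f {..<N} \<le> sum ?f {..<M ^ N}" by (intro sum_mono2) auto
    also note bound
    also have "(\<Sum>n<N. (real M - 1) * q ^ n) \<le> (\<Sum>n. (real M - 1) * q ^ n)"
      using q assms(1) by (intro sum_le_suminf summable_mult summable_geometric) auto
    finally show "sum ?f {..<N} \<le> (\<Sum>n. (real M - 1) * q ^ n)" .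
  qed simp
qed

theorem close_to_long_APs_if_not_summable:
  fixes X :: "nat set"
  assumes "\<not> summable (\<lambda>n. if n \<in> X then 1 / real n else 0)"
  shows "close_to_long_APs (int ` X)"
  unfolding close_to_long_APs_def
proof (intro allI impI)
  fix k :: nat and \<epsilon> :: real
  assume k: "1 \<le> k" and "0 < \<epsilon>"
  obtain m0 :: nat where m0: "1 / \<epsilon> \<le> real m0" using real_arch_simple by blast
  \<comment> \<open>The summand 2 secures \<open>k * m \<ge> 2\<close>, the condition on the base
    \<open>M\<close>, even for \<open>k = 1\<close>.\<close>
  define m where "m = m0 + 2"
  have m: "m \<ge> 2" "1 \<le> \<epsilon> * real m"
    using m0 \<open>0 < \<epsilon>\<close> by (auto simp: m_def field_simps)
  have "k * m \<ge> 2" using k m(1) by (metis mult_le_mono nat_mult_1)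
  \<comment> \<open>Divergence excludes the sparse bound for base \<open>k * m\<close>, so by
    contraposition the gap property fails: at some \<open>a\<close> and \<open>L\<close> all
    \<open>k * m\<close> blocks meet \<open>X\<close>.\<close>
  then have "\<not> (\<forall>a n. card (X \<inter> {a..<a + (k * m) ^ n}) \<le> (k * m - 1) ^ n)"
    using assms summable_reciprocals_if_sparse by blast
  then obtain a L where "L > 0"
    and full: "\<And>i. i < k * m \<Longrightarrow> X \<inter> {a + i * L..<a + (i + 1) * L} \<noteq> {}"
    using card_interval_le_pow[of "k * m" X] by metis
  define \<Delta> where "\<Delta> = real m * real L"
  define P where "P = {real a + real i * \<Delta> | i. i < k}"
  have "arithmetic_progression k \<Delta> P"
    using k m \<open>L > 0\<close> by (auto simp: arithmetic_progression_def \<Delta>_def P_def)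
  moreover have "(SUP p\<in>P. INF x\<in>int ` X. ereal \<bar>p - real_of_int x\<bar>) \<le> ereal (\<epsilon> * \<Delta>)"
  proof (rule SUP_least)
    fix p assume "p \<in> P"
    then obtain i where i: "i < k" "p = real a + real i * \<Delta>" by (auto simp: P_def)
    then have "i * m < k * m" using m by simp
    \<comment> \<open>Block \<open>i * m\<close> starts exactly at the \<open>i\<close>-th point
      \<open>p\<close> of the progression, so its element of \<open>X\<close> is within
      \<open>L\<close> of \<open>p\<close>.\<close>
    then obtain x where x: "x \<in> X" "a + i * m * L \<le> x" "x < a + (i * m + 1) * L"
      using full[of "i * m"] by auto
    have p: "p = real (a + i * m * L)" by (simp add: i \<Delta>_def)
    have "x < a + i * m * L + L" using x(3) by simp
    then have "real x < p + real L" unfolding p by (metis of_nat_add of_nat_less_iff)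
    moreover have "p \<le> real x" unfolding p using x(2) by (simp only: of_nat_le_iff)
    moreover have "real L \<le> \<epsilon> * \<Delta>"
      using mult_right_mono[OF m(2), of "real L"] by (simp add: \<Delta>_def mult.assoc)
    ultimately have "\<bar>p - real_of_int (int x)\<bar> \<le> \<epsilon> * \<Delta>" by simp
    then show "(INF x\<in>int ` X. ereal \<bar>p - real_of_int x\<bar>) \<le> ereal (\<epsilon> * \<Delta>)"
      using x(1) by (intro INF_lower2[of "int x"]) auto
  qed
  ultimately show "\<exists>\<Delta> P. arithmetic_progression k \<Delta> P \<and>
      (SUP p\<in>P. INF x\<in>int ` X. ereal \<bar>p - real_of_int x\<bar>) \<le> ereal (\<epsilon> * \<Delta>)"
    by blast
qed

theorem theorem1p3:
  shows "close_to_long_APs {p::int. prime p}"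
proof -
  \<comment> \<open>Primes are normalised, so no negative integer satisfies
    \<open>prime\<close>.\<close>
  have "{p::int. prime p} = int ` {p::nat. prime p}"
    by (auto simp: image_iff) (metis prime_ge_0_int prime_int_nat_transfer int_nat_eq)
  then show ?thesis
    using close_to_long_APs_if_not_summable[OF not_summable_reciprocal_primes] by simp
qed

end
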